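(* For every integer $n \ge 1$, the number of parity palindrome compositions of $2n$ equals $2\cdot 3^{n-1}$, and the number of parity palindrome compositions of $2n+1$ also equals $2\cdot 3^{n-1}$.
   Context: A composition of a positive integer $m$ is a finite ordered sequence $(a_1,a_2,\dots,a_k)$ of positive integers (its parts), $k\ge 1$, with $a_1+a_2+\cdots+a_k=m$. A parity palindrome composition of $m$ is a composition $(a_1,\dots,a_k)$ of $m$ such that $a_i \equiv a_{k+1-i} \pmod 2$ for every $i=1,\dots,k$, i.e., the sequence of parts reads the same forward and backward when reduced modulo $2$. For example, $(3,2,1,4,1)$ is a parity palindrome composition of $11$. *)

theory Defs
  imports "HOL-Number_Theory.Cong"
begin

definition composition :: "nat \<Rightarrow> nat list \<Rightarrow> bool" where
  "composition m as \<longleftrightarrow> as \<noteq> [] \<and> (\<forall>a\<in>set as. a > 0) \<and> sum_list as = m"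

(* Lists are indexed from 0, so the part opposite to index i is at length as - 1 - i. *)
definition parity_palindrome_composition :: "nat \<Rightarrow> nat list \<Rightarrow> bool" where
  "parity_palindrome_composition m as \<longleftrightarrow>
     composition m as \<and>
     (\<forall>i<length as. [as ! i = as ! (length as - 1 - i)] (mod 2))"

end

theory Submission
  imports Defs
begin

text \<open>Removing the first and the last part of a parity palindrome composition of \<open>m\<close> with at least
  two parts leaves a (possibly empty) parity palindrome of \<open>m - 2k\<close>, where \<open>2k\<close> is the sum of
  the removed parts; there are \<open>2k - 1\<close> choices for these. So the numbers \<open>f n\<close> of parity
  palindromes of \<open>2n + r\<close>, for \<open>r \<in> {0,1}\<close>, satisfy
  \<open>f n = 1 + (\<Sum>j<n. (2(n - j) - 1) f j)\<close> for \<open>n \<ge> 1\<close>, which together with \<open>f 0 = 1\<close> forces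
  \<open>f n = 2 \<cdot> 3\<^bsup>n-1\<^esup>\<close>.\<close>

text \<open>Unlike in \<^const>\<open>parity_palindrome_composition\<close>, the empty list is allowed here.\<close>

definition parity_palindromes :: "nat \<Rightarrow> nat list set" where
  "parity_palindromes m =
     {xs. (\<forall>a\<in>set xs. a > 0) \<and> sum_list xs = m \<and> rev (map even xs) = map even xs}"

text \<open>The index condition becomes an equation between lists, from which the two end parts can
  be peeled off by simplification, without index arithmetic.\<close>

lemma rev_map_even_eq_iff:
  "rev (map even xs) = map even xs \<longleftrightarrow>
     (\<forall>i<length xs. [xs ! i = xs ! (length xs - 1 - i)] (mod 2))" for xs :: "nat list"
proof -
  have parity: "[a = b] (mod 2) \<longleftrightarrow> even b = even a" for a b :: nat
    unfolding cong_def by presburger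
  have "rev (map even xs) ! i = even (xs ! (length xs - 1 - i))" if "i < length xs" for i
    using that by (simp add: rev_nth)
  then show ?thesis
    unfolding list_eq_iff_nth_eq parity length_rev length_map by (metis nth_map)
qed

lemma parity_palindrome_compositions_eq:
  assumes "m > 0"
  shows "{as. parity_palindrome_composition m as} = parity_palindromes m"
proof -
  have "as \<noteq> []" if "sum_list as = m" for as
    using that assms by auto
  then show ?thesis
    unfolding parity_palindromes_def parity_palindrome_composition_def composition_def
      rev_map_even_eq_iff
    by blast
qed

lemma parity_palindromes_0: "parity_palindromes 0 = {[]}"
proof -
  have "xs = []" if "\<forall>a\<in>set xs. a > 0" "sum_list xs = 0" for xs :: "nat list"
    using that by (cases xs) auto
  then show ?thesis
    by (auto simp: parity_palindromes_def)
qed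

lemma parity_palindromes_1: "parity_palindromes 1 = {[1]}"
proof -
  have "xs = [1]" if "\<forall>a\<in>set xs. a > 0" "sum_list xs = 1" for xs :: "nat list"
  proof (cases xs)
    case (Cons a ys)
    with that have "a > 0" "a + sum_list ys = 1"
      by simp_all
    then have "a = 1" "sum_list ys = 0"
      by linarith+
    with that Cons show ?thesis
      by (cases ys) auto
  qed (use that in simp)
  then show ?thesis
    by (auto simp: parity_palindromes_def)
qed

lemma finite_parity_palindromes: "finite (parity_palindromes m)"
proof (rule finite_subset)
  have "length xs \<le> sum_list xs" if "\<forall>a\<in>set xs. a > 0" for xs :: "nat list"
    using that by (induction xs) auto
  then show "parity_palindromes m \<subseteq> {xs. set xs \<subseteq> {..m} \<and> length xs \<le> m}"
    by (auto simp: parity_palindromes_def member_le_sum_list)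
qed (simp add: finite_lists_length_le)

text \<open>The outer parts face each other, so they only need equal parity, that is
  \<open>even (a + b)\<close>. The bound \<open>a + b \<le> m\<close> guards the truncated
  subtraction.\<close>

lemma parity_palindromes_Cons_snoc_iff:
  "a # xs @ [b] \<in> parity_palindromes m \<longleftrightarrow>
     a > 0 \<and> b > 0 \<and> even (a + b) \<and> a + b \<le> m \<and> xs \<in> parity_palindromes (m - (a + b))"
proof -
  have "rev (map even (a # xs @ [b])) = map even (a # xs @ [b]) \<longleftrightarrow>
      even (a + b) \<and> rev (map even xs) = map even xs"
    by auto
  moreover have "sum_list (a # xs @ [b]) = m \<longleftrightarrow> a + b \<le> m \<and> sum_list xs = m - (a + b)"
    by auto
  moreover have "(\<forall>x\<in>set (a # xs @ [b]). x > 0) \<longleftrightarrow> a > 0 \<and> b > 0 \<and> (\<forall>x\<in>set xs. x > 0)"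
    by auto
  ultimately show ?thesis
    unfolding parity_palindromes_def mem_Collect_eq by blast
qed

text \<open>A list is a single part or has two end parts around an inner list. The index
  \<open>j\<close> records that the inner list sums to \<open>2 * j + r\<close>; it fixes the sum
  \<open>2 * (n - j)\<close> of the end parts, so the last part is determined by \<open>j\<close>
  and the first part \<open>a\<close>.\<close>

lemma parity_palindromes_decompose:
  assumes "n > 0" "r < 2"
  shows "parity_palindromes (2 * n + r) =
    insert [2 * n + r] ((\<lambda>(j, a, xs). a # xs @ [2 * (n - j) - a]) `
      (SIGMA j:{..<n}. {1..<2 * (n - j)} \<times> parity_palindromes (2 * j + r)))"
    (is "?P = insert _ (?f ` ?S)")
proof (intro equalityI subsetI)
  fix xs assume xs: "xs \<in> ?P"
  then have "xs \<noteq> []"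
    using assms by (auto simp: parity_palindromes_def)
  then consider a where "xs = [a]" | a ys b where "xs = a # ys @ [b]"
    by (metis append_butlast_last_id list.exhaust)
  then show "xs \<in> insert [2 * n + r] (?f ` ?S)"
  proof cases
    case 1
    with xs show ?thesis
      by (simp add: parity_palindromes_def)
  next
    case (2 a ys b)
    with xs have ab: "a > 0" "b > 0" "even (a + b)" "a + b \<le> 2 * n + r"
      and ys: "ys \<in> parity_palindromes (2 * n + r - (a + b))"
      by (simp_all only: parity_palindromes_Cons_snoc_iff)
    from \<open>even (a + b)\<close> obtain k where k: "a + b = 2 * k" ..
    define j where "j = n - k"
    \<comment> \<open>From \<open>2 * k \<le> 2 * n + r\<close> and \<open>r < 2\<close> follows
      \<open>k \<le> n\<close>, so the subtraction in \<open>j\<close> is exact;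
      \<open>j < n\<close> because \<open>k > 0\<close>.\<close>
    have j: "k \<le> n" "j < n" "2 * (n - j) = a + b" "2 * n + r - (a + b) = 2 * j + r"
      using ab k assms by (auto simp: j_def)
    have "xs = ?f (j, a, ys)"
      using 2 j by simp
    moreover have "(j, a, ys) \<in> ?S"
      using ab ys j by auto
    ultimately show ?thesis
      by blast
  qed
next
  fix xs assume "xs \<in> insert [2 * n + r] (?f ` ?S)"
  then consider "xs = [2 * n + r]"
    | j a ys where "xs = a # ys @ [2 * (n - j) - a]" "j < n" "0 < a" "a < 2 * (n - j)"
        "ys \<in> parity_palindromes (2 * j + r)"
    by force
  then show "xs \<in> ?P"
  proof cases
    case 1
    with assms show ?thesis
      by (simp add: parity_palindromes_def)
  next
    case (2 j a ys)
    then have "a + (2 * (n - j) - a) = 2 * (n - j)" "2 * n + r - 2 * (n - j) = 2 * j + r"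
      by auto
    with 2 show ?thesis
      unfolding \<open>xs = _\<close> parity_palindromes_Cons_snoc_iff by simp
  qed
qed

lemma card_parity_palindromes_rec:
  assumes "n > 0" "r < 2"
  shows "card (parity_palindromes (2 * n + r)) =
    Suc (\<Sum>j<n. (2 * (n - j) - 1) * card (parity_palindromes (2 * j + r)))"
proof -
  define S where
    "S = (SIGMA j:{..<n}. {1..<2 * (n - j)} \<times> parity_palindromes (2 * j + r))"
  define f where "f = (\<lambda>(j, a, xs). a # xs @ [2 * (n - j) - a])"
  have "inj_on f S"
  proof (rule inj_onI)
    fix s t assume "s \<in> S" "t \<in> S" and eq: "f s = f t"
    obtain j a xs j' a' xs' where st: "s = (j, a, xs)" "t = (j', a', xs')"
      by (metis prod_cases3)
    have "a < 2 * (n - j)" "a' < 2 * (n - j')"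
      using \<open>s \<in> S\<close> \<open>t \<in> S\<close> by (simp_all add: S_def st)
    moreover have "a = a'" "xs = xs'" "2 * (n - j) - a = 2 * (n - j') - a'"
      using eq by (auto simp: f_def st)
    \<comment> \<open>Both subtractions are exact, so adding \<open>a\<close> back gives
      \<open>2 * (n - j) = 2 * (n - j')\<close>. As this is positive, \<open>j\<close> and
      \<open>j'\<close> agree.\<close>
    moreover from calculation have "j = j'"
      by linarith
    ultimately show "s = t"
      unfolding st by blast
  qed
  then have "card (f ` S) = card S"
    by (rule card_image)
  also have "\<dots> = (\<Sum>j<n. (2 * (n - j) - 1) * card (parity_palindromes (2 * j + r)))"
    unfolding S_def
    by (subst card_SigmaI) (auto simp: card_cartesian_product finite_parity_palindromes)
  finally have card: "card (f ` S) = \<dots>" .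
  have "finite (f ` S)"
    unfolding S_def by (intro finite_imageI finite_SigmaI) (auto simp: finite_parity_palindromes)
  moreover have "[2 * n + r] \<notin> f ` S"
    by (auto simp: f_def)
  ultimately show ?thesis
    using card parity_palindromes_decompose[OF assms] by (simp add: f_def S_def)
qed

text \<open>Passing from \<open>n\<close> to \<open>n + 1\<close> raises every weight in the
  recurrence by 2, so subtracting consecutive instances leaves only a plain prefix sum of
  \<open>f\<close>.\<close>

lemma odd_weighted_recurrence_solution:
  fixes f :: "nat \<Rightarrow> nat"
  assumes "f 0 = 1"
    and rec: "\<And>n. n > 0 \<Longrightarrow> f n = Suc (\<Sum>j<n. (2 * (n - j) - 1) * f j)"
  shows "f (Suc n) = 2 * 3 ^ n"
proof -
  \<comment> \<open>The prefix sum appears in the differenced recurrence, so its value is carried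
    through the induction too.\<close>
  have "f (Suc n) = 2 * 3 ^ n \<and> (\<Sum>j<Suc n. f j) = 3 ^ n"
  proof (induction n)
    case 0
    show ?case
      using assms(1) rec[of 1] by simp
  next
    case (Suc n)
    have "(\<Sum>j<Suc n. (2 * (Suc (Suc n) - j) - 1) * f j) =
        (\<Sum>j<Suc n. (2 * (Suc n - j) - 1) * f j + 2 * f j)"
    proof (rule sum.cong)
      fix j assume "j \<in> {..<Suc n}"
      then have "2 * (Suc (Suc n) - j) - 1 = (2 * (Suc n - j) - 1) + 2"
        by auto
      then show "(2 * (Suc (Suc n) - j) - 1) * f j = (2 * (Suc n - j) - 1) * f j + 2 * f j"
        by (simp only: distrib_right)
    qed simp
    also have "\<dots> = (\<Sum>j<Suc n. (2 * (Suc n - j) - 1) * f j) + 2 * (\<Sum>j<Suc n. f j)"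
      by (simp only: sum.distrib sum_distrib_left)
    \<comment> \<open>The last summand is the new term \<open>j = Suc n\<close>, whose weight is 1.
      By the induction hypothesis each of the three summands equals
      \<open>2 * 3 ^ n\<close>.\<close>
    finally have "f (Suc (Suc n)) = f (Suc n) + 2 * (\<Sum>j<Suc n. f j) + f (Suc n)"
      using rec[of "Suc n"] rec[of "Suc (Suc n)"] sum.lessThan_Suc[of _ "Suc n"] by simp
    with Suc show ?case
      by simp
  qed
  then show ?thesis ..
qed

theorem mainTheorem1:
  fixes n :: nat
  assumes "n \<ge> 1"
  shows "card {as. parity_palindrome_composition (2 * n) as} = 2 * 3 ^ (n - 1) \<and>
         card {as. parity_palindrome_composition (2 * n + 1) as} = 2 * 3 ^ (n - 1)"
proof -
  have "card {as. parity_palindrome_composition (2 * n + r) as} = 2 * 3 ^ (n - 1)"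
    if "r < 2" for r
  proof -
    define f where "f j = card (parity_palindromes (2 * j + r))" for j
    have "r = 0 \<or> r = 1"
      using that by auto
    \<comment> \<open>The only list counted is \<open>[]\<close> for \<open>r = 0\<close> and
      \<open>[1]\<close> for \<open>r = 1\<close>; with this common initial value both parities
      follow the same recurrence.\<close>
    then have "f 0 = 1"
      by (auto simp: f_def parity_palindromes_0 parity_palindromes_1[unfolded One_nat_def])
    moreover have "f k = Suc (\<Sum>j<k. (2 * (k - j) - 1) * f j)" if "k > 0" for k
      unfolding f_def by (rule card_parity_palindromes_rec) fact+
    ultimately have "f (Suc (n - 1)) = 2 * 3 ^ (n - 1)"
      by (rule odd_weighted_recurrence_solution)
    then show ?thesis
      using assms by (simp add: f_def parity_palindrome_compositions_eq)
  qed
  from this[of 0] this[of 1] show ?thesis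
    by simp
qed

end
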